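(* Let $T>0$, $E$ a real normed space, $G\subset E$ open, $\mathfrak f:[0,T]\times G\to\mathbb{R}$ a function and $z_0\in C^0([0,T],G)$. Consider the conditions: (i) $\mathfrak f\in C^0([0,T]\times G,\mathbb{R})$; (ii) there exist $\rho>0$ and a Borel $\mathfrak m_1$-integrable function $\zeta:[0,T]\to\mathbb{R}_+$ such that for all $t\in[0,T]$ and all $u_1,u_2\in B(z_0(t),\rho)$, $|\mathfrak f(t,u_1)-\mathfrak f(t,u_2)|\le\zeta(t)\|u_1-u_2\|$; (iii) for all $t\in[0,T]$, $D_{H,2}\mathfrak f(t,z_0(t))$ exists. Let $F:C^0([0,T],G)\to\mathbb{R}$, $F(z):=\int_0^T\mathfrak f(t,z(t))\,dt$. Then: (a) under (i) and (ii), $F$ is well defined and is Lipschitzian on the ball $B_{\|\cdot\|_\infty}(z_0,\rho)$; (b) under (i), (ii) and (iii), $F$ is Hadamard differentiable at $z_0$, and for all $h\in C^0([0,T],E)$ the function $t\mapsto D_{H,2}\mathfrak f(t,z_0(t))\cdot h(t)$ is Borel and $\mathfrak m_1$-integrable on $[0,T]$, and $$D_HF(z_0)\cdot h=\int_{[0,T]}D_{H,2}\mathfrak f(t,z_0(t))\cdot h(t)\,d\mathfrak m_1(t).$$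
   Context: $C^0([0,T],E)$ carries the supremum norm $\|\cdot\|_\infty$, and $C^0([0,T],G)$ is the (open) subset of functions with values in $G$. $B(\cdot,\rho)$ and $B_{\|\cdot\|_\infty}(\cdot,\rho)$ are open balls; $\rho$ in (ii) is understood to be such that $B(z_0(t),\rho)\subset G$ for all $t\in[0,T]$. $\mathfrak m_1$ is the Borel (Lebesgue) measure on the Borel $\sigma$-algebra of $[0,T]$; $\int_0^T\cdot\,dt$ is the Riemann integral. Hadamard differential: for real normed spaces $E_1,E_2$, $U\subset E_1$ open, $\phi:U\to E_2$, $x\in U$, $v\in E_1$, $\phi$ has Hadamard variation $D^+_H\phi(x;v)$ if for all sequences $\theta_n>0$, $\theta_n\to0$, and $v_n\to v$, $\frac1{\theta_n}(\phi(x+\theta_nv_n)-\phi(x))\to D^+_H\phi(x;v)$; if it exists for all $v$ and is continuous linear in $v$, this map is $D_H\phi(x)$. $D_{H,2}$ is the partial Hadamard differential with respect to the second variable. *)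

theory Defs
  imports "HOL-Analysis.Analysis"
begin

text \<open>
  Since \<open>T\<close> is a variable, \<open>C\<^sup>0([0,T],E)\<close> is not a type.  A continuous function on \<open>[0,T]\<close> is
  identified with its extension to the real line that is constant on \<open>(-\<infinity>,0]\<close> and on \<open>[T,\<infinity>)\<close>.
  This embeds \<open>C\<^sup>0([0,T],E)\<close> linearly and isometrically in the type of bounded continuous
  functions with the supremum norm (\<open>C0_extension\<close>, \<open>norm_C0\<close>), and \<open>C0 T\<close> is its image.
\<close>

definition C0 :: "real \<Rightarrow> (real \<Rightarrow>\<^sub>C 'e::real_normed_vector) set" where
  "C0 T = {z. (\<forall>t\<le>0. apply_bcontfun z t = apply_bcontfun z 0) \<and>
              (\<forall>t\<ge>T. apply_bcontfun z t = apply_bcontfun z T)}"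

definition C0_into :: "real \<Rightarrow> 'e set \<Rightarrow> (real \<Rightarrow>\<^sub>C 'e::real_normed_vector) set" where
  "C0_into T G = {z \<in> C0 T. \<forall>t\<in>{0..T}. apply_bcontfun z t \<in> G}"

lemma subspace_C0: "subspace (C0 T)"
proof (rule subspaceI)
  show "0 \<in> C0 T" by (simp add: C0_def)
next
  fix x y :: "real \<Rightarrow>\<^sub>C 'a" assume "x \<in> C0 T" "y \<in> C0 T"
  then show "x + y \<in> C0 T"
    unfolding C0_def mem_Collect_eq plus_bcontfun.rep_eq by metis
next
  fix c and x :: "real \<Rightarrow>\<^sub>C 'a" assume "x \<in> C0 T"
  then show "c *\<^sub>R x \<in> C0 T"
    unfolding C0_def mem_Collect_eq scaleR_bcontfun.rep_eq by metis
qed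

lemma C0_value:
  assumes "T \<ge> 0" "z \<in> C0 T"
  shows "apply_bcontfun z t = apply_bcontfun z (max 0 (min T t))"
proof -
  have z: "s \<le> 0 \<Longrightarrow> apply_bcontfun z s = apply_bcontfun z 0"
          "s \<ge> T \<Longrightarrow> apply_bcontfun z s = apply_bcontfun z T" for s
    using assms(2) unfolding C0_def by blast+
  consider "t \<le> 0" | "t \<ge> T" | "0 \<le> t" "t \<le> T" by linarith
  then show ?thesis
  proof cases
    case 1
    then have "max 0 (min T t) = 0" using assms(1) by simp
    then show ?thesis using z(1)[OF 1] by (simp only:)
  next
    case 2
    then have "max 0 (min T t) = T" using assms(1) by simp
    then show ?thesis using z(2)[OF 2] by (simp only:)
  qed auto
qed

lemma C0_extension:
  fixes g :: "real \<Rightarrow> 'e::real_normed_vector"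
  assumes "T \<ge> 0" "continuous_on {0..T} g"
  shows "\<exists>!z. z \<in> C0 T \<and> (\<forall>t\<in>{0..T}. apply_bcontfun z t = g t)"
proof -
  let ?k = "\<lambda>t. g (max 0 (min T t))"
  have cont: "continuous_on UNIV ?k"
    by (rule continuous_on_compose2[OF assms(2)]) (use assms(1) in \<open>auto intro!: continuous_intros\<close>)
  have "bounded (g ` {0..T})"
    using compact_continuous_image[OF assms(2)] compact_imp_bounded by blast
  then have "bounded (range ?k)"
    by (rule bounded_subset) (use assms(1) in auto)
  with cont have "?k \<in> bcontfun" by (simp add: bcontfun_def)
  then obtain z where z: "?k = apply_bcontfun z" by (rule bcontfunE)
  have app: "apply_bcontfun z t = g (max 0 (min T t))" for t
    by (metis z)
  show ?thesis
  proof (rule ex1I[of _ z])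
    show "z \<in> C0 T \<and> (\<forall>t\<in>{0..T}. apply_bcontfun z t = g t)"
      using assms(1) by (auto simp: C0_def app max_def min_def)
  next
    fix y assume y: "y \<in> C0 T \<and> (\<forall>t\<in>{0..T}. apply_bcontfun y t = g t)"
    show "y = z"
    proof (rule bcontfun_eqI)
      fix t
      have "apply_bcontfun y t = apply_bcontfun y (max 0 (min T t))"
        using C0_value[OF assms(1)] y by blast
      then show "apply_bcontfun y t = apply_bcontfun z t"
        using y[THEN conjunct2] assms(1) by (simp add: app)
    qed
  qed
qed

lemma norm_C0:
  assumes "T \<ge> 0" "z \<in> C0 T"
  shows "norm z = (SUP t\<in>{0..T}. norm (apply_bcontfun z t))"
proof (rule antisym)
  have bdd: "bdd_above ((\<lambda>t. norm (apply_bcontfun z t)) ` {0..T})"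
    by (rule bdd_aboveI2[of _ _ "norm z"]) (rule norm_bounded)
  show "norm z \<le> (SUP t\<in>{0..T}. norm (apply_bcontfun z t))"
  proof (rule norm_bound)
    fix t
    have "norm (apply_bcontfun z t) = norm (apply_bcontfun z (max 0 (min T t)))"
      using C0_value[OF assms] by metis
    also have "\<dots> \<le> (SUP t\<in>{0..T}. norm (apply_bcontfun z t))"
      by (rule cSUP_upper[OF _ bdd]) (use assms(1) in auto)
    finally show "norm (apply_bcontfun z t) \<le> (SUP t\<in>{0..T}. norm (apply_bcontfun z t))" .
  qed
  show "(SUP t\<in>{0..T}. norm (apply_bcontfun z t)) \<le> norm z"
    by (rule cSUP_least) (use assms(1) in \<open>auto intro: norm_bounded\<close>)
qed

lemma openin_C0_into:
  assumes "open G"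
  shows "openin (top_of_set (C0 T)) (C0_into T G)"
  unfolding openin_euclidean_subtopology_iff
proof (intro conjI ballI)
  show "C0_into T G \<subseteq> C0 T" by (auto simp: C0_into_def)
next
  fix z assume z: "z \<in> C0_into T G"
  have "compact (apply_bcontfun z ` {0..T})"
    by (intro compact_continuous_image) auto
  moreover have "apply_bcontfun z ` {0..T} \<subseteq> G" using z by (auto simp: C0_into_def)
  ultimately obtain e where e: "e > 0" "(\<Union>x\<in>apply_bcontfun z ` {0..T}. ball x e) \<subseteq> G"
    using compact_subset_open_imp_ball_epsilon_subset assms by metis
  show "\<exists>e>0. \<forall>y\<in>C0 T. dist y z < e \<longrightarrow> y \<in> C0_into T G"
  proof (intro exI[of _ e] conjI ballI impI e)
    fix y assume y: "y \<in> C0 T" "dist y z < e"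
    have "dist (apply_bcontfun z t) (apply_bcontfun y t) < e" for t
      using y dist_fun_lt_imp_dist_val_lt by (metis dist_commute)
    then show "y \<in> C0_into T G" using e y by (force simp: C0_into_def)
  qed
qed

text \<open>
  The normed space \<open>E\<^sub>1\<close> is a linear subspace \<open>V\<close> of a real normed vector space type, with the
  induced norm (\<open>V = UNIV\<close> when \<open>E\<^sub>1\<close> is a type).  The open domain \<open>U\<close> of \<open>\<phi>\<close> is left out: if
  \<open>x \<in> U\<close> and \<open>U\<close> is open in \<open>V\<close>, then \<open>x + \<theta>\<^sub>n v\<^sub>n \<in> U\<close> for all large \<open>n\<close>, so the limit below does not
  depend on the values of \<open>\<phi>\<close> outside \<open>U\<close>.
\<close>

definition has_hadamard_variation ::
  "'a::real_normed_vector set \<Rightarrow> ('a \<Rightarrow> 'b::real_normed_vector) \<Rightarrow> 'a \<Rightarrow> 'a \<Rightarrow> 'b \<Rightarrow> bool" where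
  "has_hadamard_variation V \<phi> x v w \<longleftrightarrow>
     (\<forall>(\<theta> :: nat \<Rightarrow> real) (vs :: nat \<Rightarrow> 'a).
        (\<forall>n. \<theta> n > 0) \<and> \<theta> \<longlonglongrightarrow> 0 \<and> (\<forall>n. vs n \<in> V) \<and> vs \<longlonglongrightarrow> v \<longrightarrow>
        (\<lambda>n. (1 / \<theta> n) *\<^sub>R (\<phi> (x + \<theta> n *\<^sub>R vs n) - \<phi> x)) \<longlonglongrightarrow> w)"

lemma has_hadamard_variation_unique:
  assumes "v \<in> V" "has_hadamard_variation V \<phi> x v w" "has_hadamard_variation V \<phi> x v w'"
  shows "w = w'"
proof -
  have *: "(\<lambda>n. (1 / inverse (real (Suc n))) *\<^sub>R (\<phi> (x + inverse (real (Suc n)) *\<^sub>R v) - \<phi> x)) \<longlonglongrightarrow> u"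
    if "has_hadamard_variation V \<phi> x v u" for u
    using that[unfolded has_hadamard_variation_def, rule_format,
        of "\<lambda>n. inverse (real (Suc n))" "\<lambda>_. v"] assms(1) LIMSEQ_inverse_real_of_nat by simp
  show ?thesis using LIMSEQ_unique[OF *[OF assms(2)] *[OF assms(3)]] .
qed

definition hadamard_diff ::
  "'a::real_normed_vector set \<Rightarrow> ('a \<Rightarrow> 'b::real_normed_vector) \<Rightarrow> 'a \<Rightarrow> 'a \<Rightarrow> 'b" where
  "hadamard_diff V \<phi> x v = (THE w. has_hadamard_variation V \<phi> x v w)"

definition hadamard_differentiable ::
  "'a::real_normed_vector set \<Rightarrow> ('a \<Rightarrow> 'b::real_normed_vector) \<Rightarrow> 'a \<Rightarrow> bool" where
  "hadamard_differentiable V \<phi> x \<longleftrightarrow>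
     (\<forall>v\<in>V. \<exists>w. has_hadamard_variation V \<phi> x v w) \<and>
     (\<forall>u\<in>V. \<forall>v\<in>V. hadamard_diff V \<phi> x (u + v) = hadamard_diff V \<phi> x u + hadamard_diff V \<phi> x v) \<and>
     (\<forall>c. \<forall>v\<in>V. hadamard_diff V \<phi> x (c *\<^sub>R v) = c *\<^sub>R hadamard_diff V \<phi> x v) \<and>
     continuous_on V (hadamard_diff V \<phi> x)"

text \<open>
  The library's \<open>integral\<close> is the Henstock--Kurzweil integral, in which the fineness of the tagged
  divisions may vary from point to point.  The Riemann integral is the limit of the same sums as
  the mesh of the tagged division tends to zero; \<open>measure lborel K\<close> is the length of the interval \<open>K\<close>.
\<close>

definition has_riemann_integral :: "(real \<Rightarrow> real) \<Rightarrow> real \<Rightarrow> real \<Rightarrow> real \<Rightarrow> bool" where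
  "has_riemann_integral g a b I \<longleftrightarrow>
     (\<forall>e>0. \<exists>d>0. \<forall>p. p tagged_division_of {a..b} \<and> (\<forall>(x, K)\<in>p. measure lborel K < d) \<longrightarrow>
        \<bar>(\<Sum>(x, K)\<in>p. measure lborel K * g x) - I\<bar> < e)"

definition riemann_integrable :: "(real \<Rightarrow> real) \<Rightarrow> real \<Rightarrow> real \<Rightarrow> bool" where
  "riemann_integrable g a b \<longleftrightarrow> (\<exists>I. has_riemann_integral g a b I)"

definition riemann_integral :: "(real \<Rightarrow> real) \<Rightarrow> real \<Rightarrow> real \<Rightarrow> real" where
  "riemann_integral g a b = (THE I. has_riemann_integral g a b I)"

lemma has_riemann_integral_imp_has_integral:
  assumes "has_riemann_integral g a b I"
  shows "(g has_integral I) {a..b}"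
proof -
  have "(g has_integral I) (cbox a b)"
    unfolding has_integral
  proof (intro allI impI)
    fix e :: real assume "e > 0"
    then obtain d where d: "d > 0" and
      p: "\<And>p. p tagged_division_of {a..b} \<Longrightarrow> (\<forall>(x, K)\<in>p. measure lborel K < d) \<Longrightarrow>
        \<bar>(\<Sum>(x, K)\<in>p. measure lborel K * g x) - I\<bar> < e"
      using assms unfolding has_riemann_integral_def by meson
    have mesh: "measure lborel K < d"
      if D: "D tagged_division_of cbox a b" "(\<lambda>x. ball x (d / 3)) fine D" and xK: "(x, K) \<in> D" for D x K
    proof -
      obtain u v where K: "K = cbox u v" using tagged_division_ofD(4)[OF D(1) xK] by blast
      have "x \<in> K" using tagged_division_ofD(2)[OF D(1) xK] .
      then have "u \<in> K" "v \<in> K" "u \<le> v" using K by auto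
      moreover have "K \<subseteq> ball x (d / 3)" using D(2) xK by (auto simp: fine_def)
      ultimately have "u \<in> ball x (d / 3)" "v \<in> ball x (d / 3)" "u \<le> v" by blast+
      then have "v - u < d" using d(1) unfolding mem_ball dist_real_def by arith
      then show ?thesis using K \<open>u \<le> v\<close> by simp
    qed
    show "\<exists>\<gamma>. gauge \<gamma> \<and> (\<forall>D. D tagged_division_of cbox a b \<and> \<gamma> fine D \<longrightarrow>
        norm ((\<Sum>(x, k)\<in>D. measure lborel k *\<^sub>R g x) - I) < e)"
    proof (intro exI[of _ "\<lambda>x. ball x (d / 3)"] conjI allI impI)
      show "gauge (\<lambda>x. ball x (d / 3))" using d by (simp add: gauge_def)
    next
      fix D assume D: "D tagged_division_of cbox a b \<and> (\<lambda>x. ball x (d / 3)) fine D"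
      have "\<bar>(\<Sum>(x, K)\<in>D. measure lborel K * g x) - I\<bar> < e"
      proof (rule p)
        show "D tagged_division_of {a..b}" using D by simp
        show "\<forall>(x, K)\<in>D. measure lborel K < d" using mesh D by blast
      qed
      then show "norm ((\<Sum>(x, k)\<in>D. measure lborel k *\<^sub>R g x) - I) < e" by simp
    qed
  qed
  then show ?thesis by simp
qed

lemma has_riemann_integral_unique:
  "has_riemann_integral g a b I \<Longrightarrow> has_riemann_integral g a b J \<Longrightarrow> I = J"
  using has_riemann_integral_imp_has_integral has_integral_unique by blast

definition int_functional ::
  "(real \<times> 'e::real_normed_vector \<Rightarrow> real) \<Rightarrow> real \<Rightarrow> (real \<Rightarrow>\<^sub>C 'e) \<Rightarrow> real" where
  "int_functional f T z = riemann_integral (\<lambda>t. f (t, apply_bcontfun z t)) 0 T"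

end

theory Submission
  imports Defs
begin

text \<open>
  On \<open>B(z\<^sub>0,\<rho>)\<close> the functional \<open>F\<close> is a Lebesgue integral of a continuous integrand, and
  integrating (ii) shows that \<open>\<integral>\<zeta>\<close> is a Lipschitz constant.  The difference quotients of \<open>F\<close> along
  \<open>\<theta>\<^sub>n \<rightarrow> 0\<close>, \<open>v\<^sub>n \<rightarrow> v\<close> are integrals of functions that converge pointwise by (iii) and are
  eventually dominated by \<open>(\<parallel>v\<parallel> + 1) \<zeta>\<close>, so dominated convergence yields the Hadamard variation.  It
  inherits linearity from the pointwise differentials, and it is bounded by the Lipschitz constant
  of \<open>F\<close>, hence continuous.
\<close>

section \<open>Riemann integrals of continuous functions\<close>

text \<open>Uniform continuity supplies one mesh bound for the whole interval. The Henstock-Kurzweil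
  integral splits over the pieces of a tagged division, so it can be compared with the Riemann sum
  piece by piece.\<close>

lemma has_riemann_integral_continuous:
  fixes g :: "real \<Rightarrow> real"
  assumes "continuous_on {a..b} g"
  shows "has_riemann_integral g a b (integral {a..b} g)"
  unfolding has_riemann_integral_def
proof (intro allI impI)
  fix e :: real assume "e > 0"
  \<comment> \<open>The errors add up to at most \<open>c\<close> times the length of the interval,
    which is below \<open>e\<close>; the summand 1 covers intervals of length zero.\<close>
  define c where "c = e / (measure lborel {a..b} + 1)"
  have m0: "measure lborel {a..b} + 1 > 0" by (simp add: add_nonneg_pos)
  then have c: "c > 0" using \<open>e > 0\<close> by (simp add: c_def)
  have "uniformly_continuous_on {a..b} g"
    using assms compact_uniformly_continuous by blast
  then obtain d where d: "d > 0"
    and dg: "\<And>x y. x \<in> {a..b} \<Longrightarrow> y \<in> {a..b} \<Longrightarrow> dist y x < d \<Longrightarrow> dist (g y) (g x) < c"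
    using c unfolding uniformly_continuous_on_def by metis
  show "\<exists>d>0. \<forall>p. p tagged_division_of {a..b} \<and> (\<forall>(x, K)\<in>p. measure lborel K < d) \<longrightarrow>
        \<bar>(\<Sum>(x, K)\<in>p. measure lborel K * g x) - integral {a..b} g\<bar> < e"
  proof (intro exI[of _ d] conjI allI impI d)
    fix p assume p: "p tagged_division_of {a..b} \<and> (\<forall>(x, K)\<in>p. measure lborel K < d)"
    then have tp: "p tagged_division_of cbox a b" by simp
    have "g integrable_on cbox a b"
      using assms by (simp add: integrable_continuous_real)
    then have eq: "integral {a..b} g = (\<Sum>(x, K)\<in>p. integral K g)"
      using integral_combine_tagged_division_topdown[OF _ tp] by simp
    have bound: "\<bar>measure lborel K * g x - integral K g\<bar> \<le> measure lborel K * c"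
      if xK: "(x, K) \<in> p" for x K
    proof -
      obtain u v where K: "K = {u..v}"
        using tagged_division_ofD(4)[OF tp xK] by auto
      have x: "x \<in> {u..v}" using tagged_division_ofD(2)[OF tp xK] K by simp
      have sub: "{u..v} \<subseteq> {a..b}" using tagged_division_ofD(3)[OF tp xK] K by simp
      have "measure lborel K < d" using p xK by auto
      \<comment> \<open>The tag \<open>x\<close> shows that the piece is nonempty, so its measure
        really is \<open>v - u\<close>.\<close>
      then have len: "v - u < d" using K x by simp
      have gK: "g integrable_on {u..v}"
        using continuous_on_subset[OF assms sub] by (simp add: integrable_continuous_real)
      have gc: "(g has_integral integral K g) {u..v}"
        using gK K by (simp add: integrable_integral)
      have "((\<lambda>y. g x) has_integral measure lborel K *\<^sub>R g x) {u..v}"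
        using has_integral_const[of "g x" u v] K by simp
      then have "((\<lambda>y. g x - g y) has_integral (measure lborel K * g x - integral K g)) {u..v}"
        using has_integral_diff[OF _ gc] by simp
      \<comment> \<open>The error on the piece is the integral of \<open>g x - g y\<close> over
        \<open>y\<close>, an integrand bounded by \<open>c\<close>; the exceptional set of the
        estimate is empty.\<close>
      then have "norm (measure lborel K * g x - integral K g) \<le> c * measure lborel {u..v}"
      proof (rule has_integral_bound_real[rotated -2])
        show "0 \<le> c" using c by simp
        show "finite {}" by simp
        fix y assume "y \<in> {u..v} - {}"
        then have y: "y \<in> {u..v}" by simp
        have "dist y x < d" using x y len by (auto simp: dist_real_def)
        then have "dist (g y) (g x) < c" using dg x y sub by blast
        then show "norm (g x - g y) \<le> c" by (simp add: dist_real_def)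
      qed
      then show ?thesis using K by (simp add: mult.commute)
    qed
    have "\<bar>(\<Sum>(x, K)\<in>p. measure lborel K * g x) - integral {a..b} g\<bar>
        = \<bar>\<Sum>(x, K)\<in>p. measure lborel K * g x - integral K g\<bar>"
      unfolding eq by (simp add: sum_subtractf split_def)
    also have "\<dots> \<le> (\<Sum>(x, K)\<in>p. \<bar>measure lborel K * g x - integral K g\<bar>)"
      by (rule order_trans[OF sum_abs]) (simp add: split_def)
    also have "\<dots> \<le> (\<Sum>(x, K)\<in>p. measure lborel K * c)"
      by (rule sum_mono) (use bound in auto)
    also have "\<dots> = measure lborel {a..b} * c"
      using additive_content_tagged_division[OF tp]
      by (simp add: split_def flip: sum_distrib_right)
    also have "\<dots> < e"
      using \<open>e > 0\<close> m0 unfolding c_def by (simp add: divide_simps)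
    finally show "\<bar>(\<Sum>(x, K)\<in>p. measure lborel K * g x) - integral {a..b} g\<bar> < e" .
  qed
qed

lemma continuous_on_integrable_restrict_lborel:
  fixes g :: "real \<Rightarrow> real"
  assumes "continuous_on {a..b} g"
  shows "integrable (restrict_space lborel {a..b}) g"
proof -
  have "set_integrable lborel {a..b} g"
    using borel_integrable_compact[OF _ assms] by (simp add: set_integrable_def indicator_scaleR_eq_if)
  then show ?thesis by (simp add: integrable_restrict_space set_integrable_def)
qed

text \<open>For continuous integrands the Henstock-Kurzweil and Lebesgue integrals agree. The
  Lebesgue form gives access to dominated convergence.\<close>

lemma has_riemann_integral_continuous_LINT:
  fixes g :: "real \<Rightarrow> real"
  assumes "continuous_on {a..b} g"
  shows "has_riemann_integral g a b (LINT t | restrict_space lborel {a..b}. g t)"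
proof -
  have "set_integrable lborel {a..b} g"
    using continuous_on_integrable_restrict_lborel[OF assms]
    by (simp add: integrable_restrict_space set_integrable_def)
  then have "integral {a..b} g = (LINT t | restrict_space lborel {a..b}. g t)"
    using set_borel_integral_eq_integral(2)
    by (fastforce simp: integral_restrict_space set_lebesgue_integral_def)
  then show ?thesis using has_riemann_integral_continuous[OF assms] by simp
qed

lemma riemann_integral_eqI: "has_riemann_integral g a b I \<Longrightarrow> riemann_integral g a b = I"
  unfolding riemann_integral_def using has_riemann_integral_unique by blast

section \<open>Hadamard variations on a subspace\<close>

lemma hadamard_diff_eqI:
  assumes "v \<in> V" "has_hadamard_variation V \<phi> x v w"
  shows "hadamard_diff V \<phi> x v = w"
  unfolding hadamard_diff_def using has_hadamard_variation_unique assms by blast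

lemma has_hadamard_variation_hadamard_diff:
  assumes "hadamard_differentiable V \<phi> x" "v \<in> V"
  shows "has_hadamard_variation V \<phi> x v (hadamard_diff V \<phi> x v)"
  using assms hadamard_diff_eqI unfolding hadamard_differentiable_def by metis

text \<open>Along the constant direction \<open>v\<close> the points enter the ball as soon as
  \<open>\<theta> n * norm v < r\<close>. From then on the Lipschitz condition bounds the difference
  quotients, and the bound passes to the limit.\<close>

lemma has_hadamard_variation_norm_le:
  assumes V: "subspace V" "x \<in> V" "v \<in> V"
    and "r > 0" and lip: "L-lipschitz_on (V \<inter> ball x r) \<phi>"
    and var: "has_hadamard_variation V \<phi> x v w"
  shows "norm w \<le> L * norm v"
proof -
  define \<theta> where "\<theta> n = inverse (real (Suc n))" for n
  have \<theta>: "\<theta> n > 0" "\<theta> \<longlonglongrightarrow> 0" for n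
    using LIMSEQ_inverse_real_of_nat by (auto simp: \<theta>_def[abs_def])
  then have lim: "(\<lambda>n. (1 / \<theta> n) *\<^sub>R (\<phi> (x + \<theta> n *\<^sub>R v) - \<phi> x)) \<longlonglongrightarrow> w"
    using var[unfolded has_hadamard_variation_def, rule_format, of \<theta> "\<lambda>_. v"] V by simp
  have "(\<lambda>n. \<theta> n * norm v) \<longlonglongrightarrow> 0 * norm v"
    by (intro tendsto_intros \<theta>)
  then have "\<forall>\<^sub>F n in sequentially. \<theta> n * norm v < r"
    using order_tendstoD(2) \<open>r > 0\<close> by fastforce
  then have "\<forall>\<^sub>F n in sequentially. norm ((1 / \<theta> n) *\<^sub>R (\<phi> (x + \<theta> n *\<^sub>R v) - \<phi> x)) \<le> L * norm v"
  proof eventually_elim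
    case (elim n)
    have "x + \<theta> n *\<^sub>R v \<in> V \<inter> ball x r" "x \<in> V \<inter> ball x r"
      using V elim \<theta>(1)[of n] \<open>r > 0\<close>
      by (auto simp: dist_norm subspace_add subspace_scale)
    then have "norm (\<phi> (x + \<theta> n *\<^sub>R v) - \<phi> x) \<le> L * (\<theta> n * norm v)"
      using lipschitz_onD[OF lip] \<theta>(1)[of n] by (fastforce simp: dist_norm)
    then show ?case using \<theta>(1)[of n]
      by (simp add: pos_divide_le_eq mult.assoc mult.left_commute mult.commute)
  qed
  then show ?thesis
    using tendsto_upperbound[OF tendsto_norm[OF lim]] by simp
qed

text \<open>Additivity on \<open>V\<close> turns \<open>D u - D v\<close> into
  \<open>D (u - v)\<close>, so the norm bound is a Lipschitz estimate. The domain is a subspace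
  because \<open>C0 T\<close> is a set, not a type.\<close>

lemma linear_bounded_continuous_on:
  fixes D :: "'a::real_normed_vector \<Rightarrow> 'b::real_normed_vector"
  assumes V: "subspace V"
    and add: "\<And>u v. u \<in> V \<Longrightarrow> v \<in> V \<Longrightarrow> D (u + v) = D u + D v"
    and bound: "\<And>v. v \<in> V \<Longrightarrow> norm (D v) \<le> L * norm v" and "L \<ge> 0"
  shows "continuous_on V D"
proof -
  have "L-lipschitz_on V D"
  proof (rule lipschitz_onI)
    fix u v assume "u \<in> V" "v \<in> V"
    then have "D u = D (u - v) + D v" "u - v \<in> V"
      using add[of "u - v" v] V by (auto simp: subspace_diff)
    then show "dist (D u) (D v) \<le> L * dist u v"
      using bound[of "u - v"] by (simp add: dist_norm)
  qed fact
  then show ?thesis by (rule lipschitz_on_continuous_on)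
qed

section \<open>The integral functional and its Lipschitz constant\<close>

lemma continuous_on_C0_into:
  assumes "continuous_on ({0..T} \<times> G) f" "z \<in> C0_into T G"
  shows "continuous_on {0..T} (\<lambda>t. f (t, apply_bcontfun z t))"
  by (rule continuous_on_compose2[OF assms(1)])
    (use assms(2) in \<open>auto simp: C0_into_def intro!: continuous_intros\<close>)

lemma has_riemann_integral_C0_into:
  fixes f :: "real \<times> 'e::real_normed_vector \<Rightarrow> real"
  assumes "continuous_on ({0..T} \<times> G) f" "z \<in> C0_into T G"
  shows "has_riemann_integral (\<lambda>t. f (t, apply_bcontfun z t)) 0 T
    (LINT t | restrict_space lborel {0..T}. f (t, apply_bcontfun z t))"
  by (rule has_riemann_integral_continuous_LINT[OF continuous_on_C0_into[OF assms]])

lemma int_functional_eq_LINT: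
  fixes f :: "real \<times> 'e::real_normed_vector \<Rightarrow> real"
  assumes "continuous_on ({0..T} \<times> G) f" "z \<in> C0_into T G"
  shows "int_functional f T z = (LINT t | restrict_space lborel {0..T}. f (t, apply_bcontfun z t))"
  unfolding int_functional_def
  by (rule riemann_integral_eqI[OF has_riemann_integral_C0_into[OF assms]])

text \<open>The supremum distance dominates the distance at each \<open>t\<close>. Hence the
  functional is a genuine integral on the whole ball.\<close>

lemma C0_ball_subset_C0_into:
  assumes "\<forall>t\<in>{0..T}. ball (apply_bcontfun z0 t) \<rho> \<subseteq> G"
  shows "C0 T \<inter> ball z0 \<rho> \<subseteq> C0_into T G"
proof
  fix z assume z: "z \<in> C0 T \<inter> ball z0 \<rho>"
  have "apply_bcontfun z t \<in> ball (apply_bcontfun z0 t) \<rho>" for t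
    using z dist_fun_lt_imp_dist_val_lt by auto
  then show "z \<in> C0_into T G"
    using z assms unfolding C0_into_def by blast
qed

text \<open>In the pointwise estimate by \<open>\<zeta>\<close> the distance of the values at
  \<open>t\<close> is replaced by the supremum distance, a constant that leaves the
  integral.\<close>

lemma int_functional_lipschitz:
  fixes f :: "real \<times> 'e::real_normed_vector \<Rightarrow> real"
    and T :: real
  defines "M \<equiv> restrict_space lborel {0..T}"
  assumes f: "continuous_on ({0..T} \<times> G) f"
    and G: "\<forall>t\<in>{0..T}. ball (apply_bcontfun z0 t) \<rho> \<subseteq> G"
    and \<zeta>: "integrable M \<zeta>" "\<forall>t\<in>{0..T}. \<zeta> t \<ge> 0"
      "\<forall>t\<in>{0..T}. \<forall>u1\<in>ball (apply_bcontfun z0 t) \<rho>. \<forall>u2\<in>ball (apply_bcontfun z0 t) \<rho>.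
         \<bar>f (t, u1) - f (t, u2)\<bar> \<le> \<zeta> t * norm (u1 - u2)"
  shows "(LINT t | M. \<zeta> t)-lipschitz_on (C0 T \<inter> ball z0 \<rho>) (int_functional f T)"
proof (rule lipschitz_onI)
  have sp: "space M = {0..T}" by (simp add: M_def space_restrict_space)
  show "0 \<le> (LINT t | M. \<zeta> t)"
    by (rule Bochner_Integration.integral_nonneg) (use \<zeta>(2) sp in auto)
  fix x y assume xy: "x \<in> C0 T \<inter> ball z0 \<rho>" "y \<in> C0 T \<inter> ball z0 \<rho>"
  then have xyG: "x \<in> C0_into T G" "y \<in> C0_into T G"
    using C0_ball_subset_C0_into[OF G] by auto
  have int: "integrable M (\<lambda>t. f (t, apply_bcontfun z t))" if "z \<in> C0_into T G" for z
    unfolding M_def by (intro continuous_on_integrable_restrict_lborel continuous_on_C0_into[OF f that])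
  have "dist (int_functional f T x) (int_functional f T y)
      = \<bar>LINT t | M. f (t, apply_bcontfun x t) - f (t, apply_bcontfun y t)\<bar>"
    using int_functional_eq_LINT[OF f] xyG int by (simp add: dist_real_def flip: M_def)
  also have "\<dots> \<le> (LINT t | M. \<bar>f (t, apply_bcontfun x t) - f (t, apply_bcontfun y t)\<bar>)"
    by (rule integral_abs_bound)
  also have "\<dots> \<le> (LINT t | M. \<zeta> t * dist x y)"
  proof (rule integral_mono)
    show "integrable M (\<lambda>t. \<bar>f (t, apply_bcontfun x t) - f (t, apply_bcontfun y t)\<bar>)"
      using int xyG by auto
    show "integrable M (\<lambda>t. \<zeta> t * dist x y)" using \<zeta>(1) by auto
    fix t assume "t \<in> space M"
    then have t: "t \<in> {0..T}" by (simp add: sp)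
    have "apply_bcontfun x t \<in> ball (apply_bcontfun z0 t) \<rho>"
      "apply_bcontfun y t \<in> ball (apply_bcontfun z0 t) \<rho>"
      using xy dist_fun_lt_imp_dist_val_lt by auto
    then have "\<bar>f (t, apply_bcontfun x t) - f (t, apply_bcontfun y t)\<bar>
        \<le> \<zeta> t * dist (apply_bcontfun x t) (apply_bcontfun y t)"
      using \<zeta>(3) t by (simp add: dist_norm)
    also have "\<dots> \<le> \<zeta> t * dist x y"
      using \<zeta>(2) t by (intro mult_left_mono dist_bounded) auto
    finally show "\<bar>f (t, apply_bcontfun x t) - f (t, apply_bcontfun y t)\<bar> \<le> \<zeta> t * dist x y" .
  qed
  also have "\<dots> = (LINT t | M. \<zeta> t) * dist x y" by simp
  finally show "dist (int_functional f T x) (int_functional f T y) \<le> (LINT t | M. \<zeta> t) * dist x y" .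
qed

section \<open>Limits of difference quotients by dominated convergence\<close>

text \<open>The sequences are fixed here, so that quantifying over them later yields the Hadamard
  variation. Regularity of \<open>D\<close> in \<open>t\<close> is not assumed: its measurability
  and integrability come from its being a dominated pointwise limit.\<close>

lemma int_functional_difference_quotient:
  fixes f :: "real \<times> 'e::real_normed_vector \<Rightarrow> real"
    and vs :: "nat \<Rightarrow> real \<Rightarrow>\<^sub>C 'e"
    and T :: real
  defines "M \<equiv> restrict_space lborel {0..T}"
  assumes z0: "z0 \<in> C0 T"
    and f: "continuous_on ({0..T} \<times> G) f"
    and "\<rho> > 0" and G: "\<forall>t\<in>{0..T}. ball (apply_bcontfun z0 t) \<rho> \<subseteq> G"
    and \<zeta>: "integrable M \<zeta>" "\<forall>t\<in>{0..T}. \<zeta> t \<ge> 0"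
      "\<forall>t\<in>{0..T}. \<forall>u1\<in>ball (apply_bcontfun z0 t) \<rho>. \<forall>u2\<in>ball (apply_bcontfun z0 t) \<rho>.
         \<bar>f (t, u1) - f (t, u2)\<bar> \<le> \<zeta> t * norm (u1 - u2)"
    and D: "\<forall>t\<in>{0..T}. has_hadamard_variation UNIV (\<lambda>u. f (t, u)) (apply_bcontfun z0 t)
      (apply_bcontfun v t) (D t)"
    and \<theta>: "\<And>n. \<theta> n > 0" "\<theta> \<longlonglongrightarrow> 0" and vs: "\<And>n. vs n \<in> C0 T" "vs \<longlonglongrightarrow> v"
  shows "integrable M D"
    and "(\<lambda>n. (1 / \<theta> n) *\<^sub>R (int_functional f T (z0 + \<theta> n *\<^sub>R vs n) - int_functional f T z0))
      \<longlonglongrightarrow> (LINT t | M. D t)"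
proof -
  have sp: "space M = {0..T}" by (simp add: M_def space_restrict_space)
  \<comment> \<open>Any number above \<open>norm v\<close> eventually bounds
    \<open>norm (vs n)\<close>. The index \<open>N\<close> below also ensures that the perturbed
    points lie in the ball about \<open>z0\<close>.\<close>
  define B where "B = norm v + 1"
  have "(\<lambda>n. norm (vs n)) \<longlonglongrightarrow> norm v" "(\<lambda>n. \<theta> n * norm (vs n)) \<longlonglongrightarrow> 0 * norm v"
    by (intro tendsto_intros \<theta> vs)+
  then have "\<forall>\<^sub>F n in sequentially. norm (vs n) < B \<and> \<theta> n * norm (vs n) < \<rho>"
    using \<open>\<rho> > 0\<close> by (intro eventually_conj order_tendstoD(2)) (auto simp: B_def)
  then obtain N where N: "\<And>n. n \<ge> N \<Longrightarrow> norm (vs n) < B" "\<And>n. n \<ge> N \<Longrightarrow> \<theta> n * norm (vs n) < \<rho>"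
    unfolding eventually_sequentially by blast
  define z where "z n = z0 + \<theta> n *\<^sub>R vs n" for n
  have zball: "z n \<in> C0 T \<inter> ball z0 \<rho>" if "n \<ge> N" for n
    using N(2)[OF that] \<theta>(1)[of n] z0 vs(1)[of n]
    by (auto simp: z_def dist_norm subspace_add[OF subspace_C0] subspace_scale[OF subspace_C0])
  then have zG: "z n \<in> C0_into T G" if "n \<ge> N" for n
    using C0_ball_subset_C0_into[OF G] that by blast
  have z0G: "z0 \<in> C0_into T G"
    using C0_ball_subset_C0_into[OF G] z0 \<open>\<rho> > 0\<close> by auto
  define q where "q n t = (1 / \<theta> n) *\<^sub>R (f (t, apply_bcontfun (z n) t) - f (t, apply_bcontfun z0 t))" for n t
  have int: "integrable M (\<lambda>t. f (t, apply_bcontfun y t))" if "y \<in> C0_into T G" for y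
    unfolding M_def by (intro continuous_on_integrable_restrict_lborel continuous_on_C0_into[OF f that])
  have q_int: "integrable M (q n)" if "n \<ge> N" for n
    unfolding q_def using int zG[OF that] z0G by auto
  \<comment> \<open>Uniform convergence of \<open>vs\<close> makes its values at \<open>t\<close> an
    admissible sequence of directions in the definition of the variation at \<open>t\<close>. The
    shift by \<open>N\<close> keeps only quotients known to be integrable and dominated.\<close>
  have q_lim: "(\<lambda>n. q (n + N) t) \<longlonglongrightarrow> D t" if t: "t \<in> {0..T}" for t
  proof -
    have "(\<lambda>n. apply_bcontfun (vs n) t) \<longlonglongrightarrow> apply_bcontfun v t"
      by (rule metric_tendsto_imp_tendsto[OF vs(2)]) (simp add: dist_bounded)
    then have "(\<lambda>n. q n t) \<longlonglongrightarrow> D t"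
      using D[rule_format, OF t] \<theta> unfolding has_hadamard_variation_def
      by (simp add: q_def z_def plus_bcontfun.rep_eq scaleR_bcontfun.rep_eq)
    then show ?thesis by (rule LIMSEQ_ignore_initial_segment)
  qed
  have q_bound: "\<bar>q n t\<bar> \<le> \<zeta> t * B" if n: "n \<ge> N" and t: "t \<in> {0..T}" for n t
  proof -
    have "apply_bcontfun (z n) t \<in> ball (apply_bcontfun z0 t) \<rho>"
      "apply_bcontfun z0 t \<in> ball (apply_bcontfun z0 t) \<rho>"
      using zball[OF n] dist_fun_lt_imp_dist_val_lt \<open>\<rho> > 0\<close> by auto
    then have "\<bar>f (t, apply_bcontfun (z n) t) - f (t, apply_bcontfun z0 t)\<bar>
        \<le> \<zeta> t * norm (apply_bcontfun (z n) t - apply_bcontfun z0 t)"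
      using \<zeta>(3) t by blast
    \<comment> \<open>The extracted factor \<open>\<theta> n\<close> cancels the
      \<open>1 / \<theta> n\<close> in \<open>q\<close>, which leaves a bound independent of
      \<open>n\<close>.\<close>
    also have "\<dots> = \<theta> n * (\<zeta> t * norm (apply_bcontfun (vs n) t))"
      using \<theta>(1)[of n] by (simp add: z_def plus_bcontfun.rep_eq scaleR_bcontfun.rep_eq)
    also have "\<dots> \<le> \<theta> n * (\<zeta> t * B)"
      using \<theta>(1)[of n] \<zeta>(2) t N(1)[OF n] norm_bounded[of "vs n" t]
      by (intro mult_left_mono) auto
    finally show ?thesis using \<theta>(1)[of n] by (simp add: q_def abs_mult field_simps)
  qed
  have D_meas: "D \<in> borel_measurable M"
    by (rule borel_measurable_LIMSEQ_real[of M "\<lambda>n. q (n + N)"])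
      (use q_lim q_int sp in auto)
  have w: "integrable M (\<lambda>t. \<zeta> t * B)" using \<zeta>(1) by auto
  have lim: "AE t in M. (\<lambda>n. q (n + N) t) \<longlonglongrightarrow> D t"
    using q_lim sp by (auto intro: AE_I2)
  have bnd: "AE t in M. norm (q (n + N) t) \<le> \<zeta> t * B" for n
    using q_bound sp by (auto intro: AE_I2)
  have q_meas: "q (n + N) \<in> borel_measurable M" for n using q_int[of "n + N"] by auto
  show "integrable M D"
    by (rule integrable_dominated_convergence[OF D_meas q_meas w lim bnd])
  have conv: "(\<lambda>n. LINT t | M. q (n + N) t) \<longlonglongrightarrow> (LINT t | M. D t)"
    by (rule integral_dominated_convergence[OF D_meas q_meas w lim bnd])
  \<comment> \<open>From \<open>N\<close> on both points lie in \<open>C0_into T G\<close>, so both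
    values of the functional are Lebesgue integrals and linearity applies.\<close>
  have "(LINT t | M. q n t) = (1 / \<theta> n) *\<^sub>R (int_functional f T (z n) - int_functional f T z0)"
    if "n \<ge> N" for n
    unfolding q_def using int zG[OF that] z0G int_functional_eq_LINT[OF f] by (simp flip: M_def)
  then have "(\<lambda>n. (1 / \<theta> (n + N)) *\<^sub>R (int_functional f T (z (n + N)) - int_functional f T z0))
      \<longlonglongrightarrow> (LINT t | M. D t)"
    using conv by simp
  then show "(\<lambda>n. (1 / \<theta> n) *\<^sub>R (int_functional f T (z0 + \<theta> n *\<^sub>R vs n) - int_functional f T z0))
      \<longlonglongrightarrow> (LINT t | M. D t)"
    unfolding z_def by (rule LIMSEQ_offset)
qed

section \<open>Lipschitz continuity and Hadamard differentiability of the functional\<close>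

theorem lemma5p2:
  fixes T \<rho> :: real
    and G :: "'e::real_normed_vector set"
    and f :: "real \<times> 'e \<Rightarrow> real"
    and z0 :: "real \<Rightarrow>\<^sub>C 'e"
    and \<zeta> :: "real \<Rightarrow> real"
  assumes "T > 0"
    and "open G"
    and "z0 \<in> C0_into T G"
    and i: "continuous_on ({0..T} \<times> G) f"
    and ii: "\<rho> > 0"
      "\<forall>t\<in>{0..T}. ball (apply_bcontfun z0 t) \<rho> \<subseteq> G"
      "integrable (restrict_space lborel {0..T}) \<zeta>"
      "\<forall>t\<in>{0..T}. \<zeta> t \<ge> 0"
      "\<forall>t\<in>{0..T}. \<forall>u1\<in>ball (apply_bcontfun z0 t) \<rho>. \<forall>u2\<in>ball (apply_bcontfun z0 t) \<rho>.
         \<bar>f (t, u1) - f (t, u2)\<bar> \<le> \<zeta> t * norm (u1 - u2)"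
  shows "((\<forall>z\<in>C0_into T G. riemann_integrable (\<lambda>t. f (t, apply_bcontfun z t)) 0 T) \<and>
          (\<exists>L. L-lipschitz_on (C0 T \<inter> ball z0 \<rho>) (int_functional f T))) \<and>
         ((\<forall>t\<in>{0..T}. hadamard_differentiable UNIV (\<lambda>u. f (t, u)) (apply_bcontfun z0 t)) \<longrightarrow>
          hadamard_differentiable (C0 T) (int_functional f T) z0 \<and>
          (\<forall>h\<in>C0 T.
             (\<lambda>t. hadamard_diff UNIV (\<lambda>u. f (t, u)) (apply_bcontfun z0 t) (apply_bcontfun h t))
               \<in> borel_measurable (restrict_space borel {0..T}) \<and>
             integrable (restrict_space lborel {0..T})
               (\<lambda>t. hadamard_diff UNIV (\<lambda>u. f (t, u)) (apply_bcontfun z0 t) (apply_bcontfun h t)) \<and>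
             hadamard_diff (C0 T) (int_functional f T) z0 h =
               (LINT t | restrict_space lborel {0..T}.
                  hadamard_diff UNIV (\<lambda>u. f (t, u)) (apply_bcontfun z0 t) (apply_bcontfun h t))))"
proof -
  let ?M = "restrict_space lborel {0..T}"
  let ?F = "int_functional f T"
  let ?D = "\<lambda>t u. hadamard_diff UNIV (\<lambda>u. f (t, u)) (apply_bcontfun z0 t) u"
  have z0: "z0 \<in> C0 T" using assms(3) by (simp add: C0_into_def)
  have sp: "space ?M = {0..T}" by (simp add: space_restrict_space)
  have "\<forall>z\<in>C0_into T G. riemann_integrable (\<lambda>t. f (t, apply_bcontfun z t)) 0 T"
    using has_riemann_integral_C0_into[OF i] unfolding riemann_integrable_def by blast
  moreover have lip: "(LINT t | ?M. \<zeta> t)-lipschitz_on (C0 T \<inter> ball z0 \<rho>) ?F"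
    by (rule int_functional_lipschitz[OF i ii(2-5)])
  moreover have "hadamard_differentiable (C0 T) ?F z0 \<and>
      (\<forall>h\<in>C0 T. (\<lambda>t. ?D t (apply_bcontfun h t)) \<in> borel_measurable (restrict_space borel {0..T}) \<and>
        integrable ?M (\<lambda>t. ?D t (apply_bcontfun h t)) \<and>
        hadamard_diff (C0 T) ?F z0 h = (LINT t | ?M. ?D t (apply_bcontfun h t)))"
    if iii: "\<forall>t\<in>{0..T}. hadamard_differentiable UNIV (\<lambda>u. f (t, u)) (apply_bcontfun z0 t)"
  proof -
    have var: "\<forall>t\<in>{0..T}. has_hadamard_variation UNIV (\<lambda>u. f (t, u)) (apply_bcontfun z0 t)
        (apply_bcontfun h t) (?D t (apply_bcontfun h t))" for h
      using has_hadamard_variation_hadamard_diff iii by blast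
    note quot = int_functional_difference_quotient[OF z0 i ii var]
    \<comment> \<open>Integrability does not mention sequences, so one admissible choice suffices:
      steps \<open>1 / (n + 1)\<close> in the constant direction \<open>h\<close>.\<close>
    have int: "integrable ?M (\<lambda>t. ?D t (apply_bcontfun h t))" if "h \<in> C0 T" for h
      by (rule quot(1)[of "\<lambda>n. inverse (real (Suc n))" "\<lambda>_. h"])
        (use that LIMSEQ_inverse_real_of_nat in auto)
    have meas: "(\<lambda>t. ?D t (apply_bcontfun h t)) \<in> borel_measurable (restrict_space borel {0..T})"
      if "h \<in> C0 T" for h
      \<comment> \<open>\<open>lborel\<close> and \<open>borel\<close> have the same measurable
        sets, also after restriction to the interval.\<close>
      using borel_measurable_integrable[OF int[OF that]]
        measurable_cong_sets[OF sets_restrict_space_cong[OF sets_lborel] refl] by blast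
    have varF: "has_hadamard_variation (C0 T) ?F z0 h (LINT t | ?M. ?D t (apply_bcontfun h t))" for h
      unfolding has_hadamard_variation_def using quot(2) by blast
    have diffF: "hadamard_diff (C0 T) ?F z0 h = (LINT t | ?M. ?D t (apply_bcontfun h t))"
      if "h \<in> C0 T" for h
      by (rule hadamard_diff_eqI[OF that varF])
    have addF: "hadamard_diff (C0 T) ?F z0 (u + v)
        = hadamard_diff (C0 T) ?F z0 u + hadamard_diff (C0 T) ?F z0 v"
      if uv: "u \<in> C0 T" "v \<in> C0 T" for u v
    proof -
      \<comment> \<open>Additivity holds under the integral for each \<open>t\<close> by (iii);
        integrability of both summands then splits the integral.\<close>
      have "(LINT t | ?M. ?D t (apply_bcontfun (u + v) t))
          = (LINT t | ?M. ?D t (apply_bcontfun u t) + ?D t (apply_bcontfun v t))"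
        using iii by (intro Bochner_Integration.integral_cong)
          (auto simp: sp plus_bcontfun.rep_eq hadamard_differentiable_def)
      then show ?thesis
        using uv int by (simp add: diffF subspace_add[OF subspace_C0])
    qed
    have scaleF: "hadamard_diff (C0 T) ?F z0 (c *\<^sub>R v) = c *\<^sub>R hadamard_diff (C0 T) ?F z0 v"
      if v: "v \<in> C0 T" for c v
    proof -
      have "(LINT t | ?M. ?D t (apply_bcontfun (c *\<^sub>R v) t))
          = (LINT t | ?M. c * ?D t (apply_bcontfun v t))"
        using iii by (intro Bochner_Integration.integral_cong)
          (auto simp: sp scaleR_bcontfun.rep_eq hadamard_differentiable_def)
      then show ?thesis
        using v by (simp add: diffF subspace_scale[OF subspace_C0])
    qed
    \<comment> \<open>The Lipschitz constant of the functional near \<open>z0\<close> bounds each of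
      its variations there, and additivity does the rest.\<close>
    have "continuous_on (C0 T) (hadamard_diff (C0 T) ?F z0)"
    proof (rule linear_bounded_continuous_on[OF subspace_C0 addF])
      show "norm (hadamard_diff (C0 T) ?F z0 v) \<le> (LINT t | ?M. \<zeta> t) * norm v" if "v \<in> C0 T" for v
        using has_hadamard_variation_norm_le[OF subspace_C0 z0 that ii(1) lip varF]
        by (simp add: diffF[OF that])
      show "0 \<le> (LINT t | ?M. \<zeta> t)" by (rule lipschitz_on_nonneg[OF lip])
    qed
    then have "hadamard_differentiable (C0 T) ?F z0"
      unfolding hadamard_differentiable_def using varF addF scaleF by blast
    then show ?thesis using meas int diffF by blast
  qed
  ultimately show ?thesis by blast
qed

end
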